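(* Let $a,b,c,n$ be positive integers with $\gcd(a,b)=\gcd(b,c)=\gcd(c,a)=1$. Define integers as follows: $b'_1\equiv -nb^{-1}\pmod a$ with $1\le b'_1\le a$; $c'_1\equiv bc^{-1}\pmod a$ with $1\le c'_1\le a$; $c'_2\equiv -nc^{-1}\pmod b$ with $1\le c'_2\le b$; $a'_2\equiv ca^{-1}\pmod b$ with $1\le a'_2\le b$; $a'_3\equiv -na^{-1}\pmod c$ with $1\le a'_3\le c$; $b'_3\equiv ab^{-1}\pmod c$ with $1\le b'_3\le c$. Let $$N_1=n(n+a+b+c)+cbb'_1\big(a+1-c'_1(b'_1-1)\big)+acc'_2\big(b+1-a'_2(c'_2-1)\big)+baa'_3\big(c+1-b'_3(a'_3-1)\big).$$ Then the number $N(a,b,c;n)$ of solutions $(x,y,z)$ in non-negative integers of $ax+by+cz=n$ is $$N(a,b,c;n)=\frac{N_1}{2abc}+\sum_{i=1}^{b'_1-1}\Big\lfloor\frac{ic'_1}{a}\Big\rfloor+\sum_{i=1}^{c'_2-1}\Big\lfloor\frac{ia'_2}{b}\Big\rfloor+\sum_{i=1}^{a'_3-1}\Big\lfloor\frac{ib'_3}{c}\Big\rfloor-2.$$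
   Context: For integers $u,m$ with $\gcd(u,m)=1$, $u^{-1}$ modulo $m$ denotes a modular inverse of $u$ modulo $m$. $\lfloor t\rfloor$ is the greatest integer $\le t$. Empty sums are $0$. *)

theory Defs
  imports Complex_Main "HOL-Number_Theory.Modular_Inverse"
begin

definition num_solutions :: "int \<Rightarrow> int \<Rightarrow> int \<Rightarrow> int \<Rightarrow> nat" where
  "num_solutions a b c n =
     card {(x, y, z). 0 \<le> x \<and> 0 \<le> y \<and> 0 \<le> z \<and> a * x + b * y + c * z = n}"

end

theory Submission
  imports Defs
begin

text \<open>
  Counting the solutions with \<open>z = 0\<close> gives \<open>N(a,b,c;n) - N(a,b,c;n - c) = N(a,b;n)\<close>, and
  Popoviciu's formula evaluates the right-hand side. The claimed expression is a quadratic
  polynomial in \<open>n\<close> plus one periodic term for each of the moduli \<open>a\<close>, \<open>b\<close>, \<open>c\<close>, and it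
  satisfies the same recurrence. By the cyclic symmetry of both sides their difference therefore
  has the coprime periods \<open>c\<close> and \<open>a\<close> on the non-negative integers, hence is constant, and it
  vanishes at \<open>n = 0\<close>.
\<close>

section \<open>Residues normalised to the range \<open>1..m\<close>\<close>

text \<open>Multiples of \<open>m\<close> are represented by \<open>m\<close> instead of 0. This is
  the normalisation that the theorem imposes on its six residues.\<close>

definition pos_residue :: "int \<Rightarrow> int \<Rightarrow> int" where
  "pos_residue m x = (x - 1) mod m + 1"

lemma pos_residue_bounds:
  assumes "m > 0"
  shows "1 \<le> pos_residue m x" and "pos_residue m x \<le> m"
  using pos_mod_sign[OF assms, of "x - 1"] pos_mod_bound[OF assms, of "x - 1"]
  by (simp_all add: pos_residue_def)

lemma pos_residue_cong: "[pos_residue m x = x] (mod m)"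
proof -
  have "[(x - 1) mod m + 1 = (x - 1) + 1] (mod m)"
    by (intro cong_add) auto
  then show ?thesis by (simp add: pos_residue_def)
qed

lemma pos_residue_eqI:
  assumes "[x = y] (mod m)"
  shows "pos_residue m x = pos_residue m y"
proof -
  have "[x - 1 = y - 1] (mod m)" using assms by (intro cong_diff) auto
  then show ?thesis by (simp add: pos_residue_def cong_def)
qed

lemma pos_residue_ident: "1 \<le> x \<Longrightarrow> x \<le> m \<Longrightarrow> pos_residue m x = x"
  by (simp add: pos_residue_def)

lemma pos_residue_eq_modulus_iff:
  assumes "m > 0"
  shows "pos_residue m x = m \<longleftrightarrow> m dvd x"
proof
  assume "pos_residue m x = m"
  then have "[m = x] (mod m)" using pos_residue_cong[of m x] by simp
  then show "m dvd x" by (simp add: cong_def mod_0_imp_dvd)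
next
  assume "m dvd x"
  then have "[x = m] (mod m)" by (simp add: cong_def)
  then show "pos_residue m x = m"
    using pos_residue_eqI[of x m m] pos_residue_ident[of m m] assms by simp
qed

lemma pos_residue_eq_mod:
  assumes "m > 0" and "\<not> m dvd x"
  shows "pos_residue m x = x mod m"
proof -
  have "x mod m \<noteq> 0" using assms by (simp add: dvd_eq_mod_eq_0)
  moreover have "0 \<le> x mod m" "x mod m < m" using assms by auto
  ultimately have "pos_residue m (x mod m) = x mod m" by (intro pos_residue_ident) auto
  then show ?thesis using pos_residue_eqI[of "x mod m" x m] by simp
qed

lemma pos_residue_add_one:
  assumes "m > 0"
  shows "pos_residue m (x + 1) = (if m dvd x then 1 else pos_residue m x + 1)"
proof -
  have c: "[pos_residue m x + 1 = x + 1] (mod m)"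
    by (intro cong_add pos_residue_cong) auto
  show ?thesis
  proof (cases "m dvd x")
    case True
    then have "[x + 1 = 0 + 1] (mod m)"
      by (intro cong_add) (auto simp: cong_0_iff)
    then have "pos_residue m (x + 1) = pos_residue m 1"
      using pos_residue_eqI by simp
    then show ?thesis using True assms by (simp add: pos_residue_ident)
  next
    case False
    then have "pos_residue m x \<noteq> m" using pos_residue_eq_modulus_iff[OF assms] by simp
    then have "pos_residue m (pos_residue m x + 1) = pos_residue m x + 1"
      using pos_residue_bounds[OF assms, of x] by (intro pos_residue_ident) auto
    then show ?thesis using False pos_residue_eqI[OF c] by simp
  qed
qed

text \<open>Used to reindex a sum over one full period after a translation by \<open>e\<close>. On a
  finite set injectivity already gives surjectivity.\<close>

lemma bij_betw_pos_residue_shift: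
  assumes "m > 0"
  shows "bij_betw (\<lambda>t. pos_residue m (t + e)) {1..m} {1..m}"
proof -
  have sub: "(\<lambda>t. pos_residue m (t + e)) ` {1..m} \<subseteq> {1..m}"
    using pos_residue_bounds[OF assms] by auto
  have inj: "inj_on (\<lambda>t. pos_residue m (t + e)) {1..m}"
  proof (rule inj_onI)
    fix x y assume xy: "x \<in> {1..m}" "y \<in> {1..m}"
      and eq: "pos_residue m (x + e) = pos_residue m (y + e)"
    have "[x + e = y + e] (mod m)"
      using pos_residue_cong[of m "x + e"] pos_residue_cong[of m "y + e"] eq
      by (metis cong_sym cong_trans)
    then have "[x = y] (mod m)" by (simp add: cong_add_rcancel)
    then have "pos_residue m x = pos_residue m y" by (rule pos_residue_eqI)
    then show "x = y" using xy by (simp add: pos_residue_ident)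
  qed
  show ?thesis
    using endo_inj_surj[OF _ sub inj] inj by (simp add: bij_betw_def)
qed

section \<open>The periodic contribution of a single modulus\<close>

lemma sum_int_upto:
  fixes m :: int
  assumes "m \<ge> 0"
  shows "2 * (\<Sum>i = 1..m. i) = m * (m + 1)"
  using assms
proof (induction m rule: int_ge_induct)
  case (step m)
  have "{1..m + 1} = insert (m + 1) {1..m}" using step by auto
  then show ?case using step by (simp add: algebra_simps)
qed simp

text \<open>Up to the factor \<open>2 * m\<close> and a constant, this is the Fourier--Dedekind part of the counting
  function that is periodic modulo \<open>m\<close>; clearing denominators keeps everything in the integers.\<close>

definition dedekind_part :: "int \<Rightarrow> int \<Rightarrow> int \<Rightarrow> int" where
  "dedekind_part m k t =
     pos_residue m t * (m + 1) - 2 * (\<Sum>i = 1..pos_residue m t - 1. i * k mod m)"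

lemma dedekind_part_cong:
  assumes "[k = k'] (mod m)" and "[t = t'] (mod m)"
  shows "dedekind_part m k t = dedekind_part m k' t'"
proof -
  have "i * k mod m = i * k' mod m" for i
    using cong_mult[OF cong_refl[of i m] assms(1)] by (simp add: cong_def)
  then show ?thesis
    by (simp add: dedekind_part_def pos_residue_eqI[OF assms(2)])
qed

text \<open>Here the sum runs over all nonzero residues, which the unit \<open>k\<close> merely
  permutes, so twice the sum is \<open>m * (m - 1)\<close>, to be subtracted from
  \<open>m * (m + 1)\<close>.\<close>

lemma dedekind_part_of_dvd:
  assumes "m > 0" and "coprime k m" and "m dvd t"
  shows "dedekind_part m k t = 2 * m"
proof -
  have "(\<Sum>i = 1..m - 1. i * k mod m) = (\<Sum>i \<in> {1..<m}. k * i mod m)"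
    by (intro sum.cong) (auto simp: mult.commute)
  also have "\<dots> = (\<Sum>i \<in> {1..<m}. i)"
    by (rule sum.reindex_bij_betw[OF bij_betw_int_remainders_mult[OF assms(2)]])
  also have "\<dots> = (\<Sum>i = 1..m - 1. i)"
    by (intro sum.cong) auto
  finally have "2 * (\<Sum>i = 1..m - 1. i * k mod m) = (m - 1) * m"
    using sum_int_upto[of "m - 1"] assms(1) by simp
  moreover have "pos_residue m t = m"
    using assms by (simp add: pos_residue_eq_modulus_iff)
  ultimately show ?thesis by (simp add: dedekind_part_def algebra_simps)
qed

text \<open>Away from multiples of \<open>m\<close>, the step lengthens the sum by the single term
  \<open>r * k mod m\<close>. At a multiple of \<open>m\<close> the value drops from
  \<open>2 * m\<close> to \<open>m + 1\<close>; the same formula covers this case because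
  \<open>pos_residue\<close> is then \<open>m\<close> and not 0.\<close>

lemma dedekind_part_add_one:
  assumes "m > 0" and "coprime k m"
  shows "dedekind_part m k (t + 1) - dedekind_part m k t = m + 1 - 2 * pos_residue m (k * t)"
proof (cases "m dvd t")
  case True
  then have "pos_residue m (t + 1) = 1" "pos_residue m (k * t) = m"
    using assms by (simp_all add: pos_residue_add_one pos_residue_eq_modulus_iff)
  then show ?thesis
    using dedekind_part_of_dvd[OF assms True] by (simp add: dedekind_part_def)
next
  case False
  define r where "r = pos_residue m t"
  have r: "r \<ge> 1" using pos_residue_bounds[OF assms(1)] by (simp add: r_def)
  have "\<not> m dvd k * t"
    using False assms(2) by (metis coprime_commute coprime_dvd_mult_right_iff)
  then have "pos_residue m (k * t) = k * t mod m"
    by (rule pos_residue_eq_mod[OF assms(1)])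
  also have "\<dots> = r * k mod m"
    using cong_mult[OF pos_residue_cong[of m t] cong_refl[of k]]
    by (simp add: r_def cong_def mult.commute)
  finally have last: "pos_residue m (k * t) = r * k mod m" .
  have "{1..r} = insert r {1..r - 1}" using r by auto
  then have "(\<Sum>i = 1..r. i * k mod m) = r * k mod m + (\<Sum>i = 1..r - 1. i * k mod m)"
    by simp
  moreover have "pos_residue m (t + 1) = r + 1"
    using False assms(1) by (simp add: pos_residue_add_one r_def)
  ultimately show ?thesis
    using last by (simp add: dedekind_part_def r_def[symmetric] algebra_simps)
qed

text \<open>This expresses the symmetry of the Fourier--Dedekind sum in its two arguments: the defect
  of the claimed identity is invariant under \<open>t \<mapsto> t + 1\<close>, and its sum over a period vanishes.\<close>

lemma dedekind_part_add_inverse: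
  assumes m: "m > 0" and ek: "[k * e = 1] (mod m)"
  shows "dedekind_part m k (t + e) - dedekind_part m k t = m + 1 - 2 * pos_residue m t"
proof -
  have cop: "coprime k m" using ek coprime_iff_invertible_int by blast
  define K where "K t = dedekind_part m k (t + e) - dedekind_part m k t
    - (m + 1) + 2 * pos_residue m t" for t
  have K_Suc: "K (t + 1) = K t" for t
  proof -
    have "dedekind_part m k (t + 1 + e) - dedekind_part m k (t + e)
        = m + 1 - 2 * pos_residue m (k * (t + e))"
      using dedekind_part_add_one[OF m cop, of "t + e"] by (simp add: algebra_simps)
    moreover have "pos_residue m (k * (t + e)) = pos_residue m (k * t + 1)"
      using cong_add[OF cong_refl[of "k * t"] ek]
      by (intro pos_residue_eqI) (simp add: algebra_simps)
    \<comment> \<open>Hence the residues of \<open>t\<close> and \<open>k * t\<close> move together: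
      both rise by 1, or both fall from \<open>m\<close> to 1, and the two changes cancel in
      \<open>K\<close>.\<close>
    moreover have "m dvd k * t \<longleftrightarrow> m dvd t"
      using cop by (metis coprime_commute coprime_dvd_mult_right_iff)
    ultimately show ?thesis
      using dedekind_part_add_one[OF m cop, of t] pos_residue_eq_modulus_iff[OF m, of t]
        pos_residue_eq_modulus_iff[OF m, of "k * t"]
      by (simp add: K_def pos_residue_add_one[OF m] split: if_splits)
  qed
  have K_const: "K t = K 0" for t
  proof (induction t rule: int_induct[where k = 0])
    case (step2 i)
    then show ?case using K_Suc[of "i - 1"] by simp
  qed (simp_all add: K_Suc)
  have "(\<Sum>t = 1..m. dedekind_part m k (t + e))
      = (\<Sum>t = 1..m. dedekind_part m k (pos_residue m (t + e)))"
    by (intro sum.cong dedekind_part_cong cong_sym[OF pos_residue_cong]) auto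
  also have "\<dots> = (\<Sum>t = 1..m. dedekind_part m k t)"
    by (rule sum.reindex_bij_betw[OF bij_betw_pos_residue_shift[OF m]])
  finally have shift: "(\<Sum>t = 1..m. dedekind_part m k (t + e)) = (\<Sum>t = 1..m. dedekind_part m k t)" .
  have "(\<Sum>t = 1..m. pos_residue m t) = (\<Sum>t = 1..m. t)"
    by (intro sum.cong) (auto simp: pos_residue_ident)
  \<comment> \<open>The \<open>dedekind_part\<close> sums cancel by \<open>shift\<close>, which
    leaves \<open>2 * (1 + ... + m) - m * (m + 1)\<close>.\<close>
  then have "(\<Sum>t = 1..m. K t) = 0"
    using shift sum_int_upto[of m] m
    by (simp add: K_def sum.distrib sum_subtractf sum_distrib_left[symmetric])
  moreover have "(\<Sum>t = 1..m. K t) = m * K 0"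
  proof -
    have "(\<Sum>t = 1..m. K t) = (\<Sum>t = 1..m. K 0)" by (intro sum.cong refl K_const)
    then show ?thesis using m by simp
  qed
  ultimately have "K 0 = 0" using m by simp
  then show ?thesis using K_const[of t] by (simp add: K_def)
qed

text \<open>Writing each remainder as dividend minus \<open>m\<close> times the floor of the
  quotient turns the sum of remainders into the shape that appears in the theorem.\<close>

lemma dedekind_part_floor:
  assumes "1 \<le> t" and "t \<le> m"
  shows "dedekind_part m k t
    = t * (m + 1 - k * (t - 1)) + 2 * m * (\<Sum>i = 1..t - 1. \<lfloor>real_of_int (i * k) / real_of_int m\<rfloor>)"
proof -
  have "i * k mod m = i * k - m * \<lfloor>real_of_int (i * k) / real_of_int m\<rfloor>" for i
    by (simp add: floor_divide_of_int_eq minus_mult_div_eq_mod del: of_int_mult)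
  then have "(\<Sum>i = 1..t - 1. i * k mod m)
      = (\<Sum>i = 1..t - 1. i) * k - m * (\<Sum>i = 1..t - 1. \<lfloor>real_of_int (i * k) / real_of_int m\<rfloor>)"
    by (simp only: sum_subtractf sum_distrib_left sum_distrib_right)
  moreover have "2 * (\<Sum>i = 1..t - 1. i) = (t - 1) * t"
    using sum_int_upto[of "t - 1"] assms by simp
  ultimately have "2 * (\<Sum>i = 1..t - 1. i * k mod m)
      = (t - 1) * t * k - 2 * m * (\<Sum>i = 1..t - 1. \<lfloor>real_of_int (i * k) / real_of_int m\<rfloor>)"
    by (simp add: right_diff_distrib mult.assoc[symmetric])
  then show ?thesis
    using assms by (simp add: dedekind_part_def pos_residue_ident) (simp add: algebra_simps)
qed

section \<open>Popoviciu's formula for two variables\<close>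

text \<open>Any solution has \<open>x\<close> congruent to \<open>- v\<close> modulo
  \<open>b\<close>, so \<open>x = b * t - v\<close> for some \<open>t\<close>, and then
  \<open>y = a * (k - t) - u\<close> where \<open>a * b * k = n + b * u + a * v\<close>. The bounds
  on \<open>v\<close> make \<open>x \<ge> 0\<close> equivalent to \<open>t \<ge> 1\<close>, those on
  \<open>u\<close> make \<open>y \<ge> 0\<close> equivalent to \<open>t \<le> k - 1\<close>.\<close>

lemma card_two_variable_solutions:
  fixes a b n u v :: int
  assumes pos: "a > 0" "b > 0" "n \<ge> 0" and cop: "coprime a b"
    and u: "1 \<le> u" "u \<le> a" "a dvd n + b * u"
    and v: "1 \<le> v" "v \<le> b" "b dvd n + a * v"
  shows "a * b * int (card {(x, y). 0 \<le> x \<and> 0 \<le> y \<and> a * x + b * y = n})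
    = n + b * u + a * v - a * b"
proof -
  have "a dvd n + b * u + a * v" "b dvd n + b * u + a * v"
    using u(3) v(3) by (simp, metis add.assoc add.commute dvd_add dvd_triv_left)
  then have "a * b dvd n + b * u + a * v" using cop by (simp add: divides_mult)
  then obtain k where k: "n + b * u + a * v = a * b * k" by (elim dvdE)
  have "a * b * k > 0" using k pos u(1) v(1) by (smt (verit) mult_pos_pos)
  \<comment> \<open>Ensures that \<open>{1..k - 1}\<close> has exactly \<open>k - 1\<close> elements
    as an integer, also when it is empty.\<close>
  then have "k \<ge> 1" using pos zero_less_mult_pos[of "a * b" k] by simp
  have "bij_betw (\<lambda>t. (b * t - v, a * (k - t) - u)) {1..k - 1}
      {(x, y). 0 \<le> x \<and> 0 \<le> y \<and> a * x + b * y = n}"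
    unfolding bij_betw_def
  proof (intro conjI equalityI subsetI)
    show "inj_on (\<lambda>t. (b * t - v, a * (k - t) - u)) {1..k - 1}"
      using pos by (auto simp: inj_on_def)
  next
    fix p assume "p \<in> (\<lambda>t. (b * t - v, a * (k - t) - u)) ` {1..k - 1}"
    then obtain t where t: "1 \<le> t" "t \<le> k - 1" and p: "p = (b * t - v, a * (k - t) - u)"
      by auto
    have "b * 1 \<le> b * t" "a * 1 \<le> a * (k - t)"
      using t pos by (auto intro!: mult_left_mono)
    then have "v \<le> b * t" "u \<le> a * (k - t)" using u v by linarith+
    moreover have "a * (b * t - v) + b * (a * (k - t) - u) = n"
      using k by (simp add: algebra_simps)
    ultimately show "p \<in> {(x, y). 0 \<le> x \<and> 0 \<le> y \<and> a * x + b * y = n}"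
      using p u v by simp
  next
    fix p assume "p \<in> {(x, y). 0 \<le> x \<and> 0 \<le> y \<and> a * x + b * y = n}"
    then obtain x y where p: "p = (x, y)" and xy: "0 \<le> x" "0 \<le> y" "a * x + b * y = n" by auto
    have "a * (x + v) = (n + a * v) - b * y" using xy by (simp add: algebra_simps)
    then have "b dvd a * (x + v)" using v(3) by simp
    then have "b dvd x + v" using cop by (simp add: coprime_commute coprime_dvd_mult_right_iff)
    then obtain t where t: "x + v = b * t" by (elim dvdE)
    have "b * t > 0" using t xy v by linarith
    then have "t \<ge> 1" using pos zero_less_mult_pos[of b t] by simp
    have x: "x = b * t - v" using t by simp
    have "b * (y + u) = b * (a * (k - t))"
      using k xy(3) unfolding x by (simp add: algebra_simps)
    then have y: "y + u = a * (k - t)" using pos by simp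
    then have "a * (k - t) > 0" using xy u by linarith
    then have "k - t \<ge> 1" using pos zero_less_mult_pos[of a "k - t"] by simp
    then show "p \<in> (\<lambda>t. (b * t - v, a * (k - t) - u)) ` {1..k - 1}"
      using \<open>t \<ge> 1\<close> x y p by (intro image_eqI[of _ _ t]) auto
  qed
  then have "card {1..k - 1} = card {(x, y). 0 \<le> x \<and> 0 \<le> y \<and> a * x + b * y = n}"
    by (rule bij_betw_same_card)
  then have "int (card {(x, y). 0 \<le> x \<and> 0 \<le> y \<and> a * x + b * y = n}) = k - 1"
    using \<open>k \<ge> 1\<close> by simp
  then show ?thesis unfolding k by (simp only: right_diff_distrib mult_1_right)
qed

section \<open>The recurrence for the three-variable count\<close>

lemma finite_solutions:
  fixes a b c n :: int
  assumes "a > 0" "b > 0" "c > 0"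
  shows "finite {(x, y, z). 0 \<le> x \<and> 0 \<le> y \<and> 0 \<le> z \<and> a * x + b * y + c * z = n}"
proof (rule finite_subset)
  have le: "w \<le> d * w" "0 \<le> d * w" if "0 \<le> w" "d > 0" for d w :: int
    using that by (simp_all add: mult_le_cancel_right1)
  show "{(x, y, z). 0 \<le> x \<and> 0 \<le> y \<and> 0 \<le> z \<and> a * x + b * y + c * z = n}
      \<subseteq> {0..n} \<times> {0..n} \<times> {0..n}"
  proof
    fix p assume "p \<in> {(x, y, z). 0 \<le> x \<and> 0 \<le> y \<and> 0 \<le> z \<and> a * x + b * y + c * z = n}"
    then obtain x y z where "p = (x, y, z)"
      and "0 \<le> x" "0 \<le> y" "0 \<le> z" "a * x + b * y + c * z = n" by auto
    then show "p \<in> {0..n} \<times> {0..n} \<times> {0..n}"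
      using le[of x a] le[of y b] le[of z c] assms by simp
  qed
qed simp

lemma num_solutions_rotate: "num_solutions a b c n = num_solutions b c a n"
  unfolding num_solutions_def
  by (rule bij_betw_same_card[of "\<lambda>(x, y, z). (y, z, x)"],
      rule bij_betw_byWitness[where f' = "\<lambda>(y, z, x). (x, y, z)"]) (auto simp: algebra_simps)

text \<open>Lowering \<open>z\<close> by 1 matches the solutions with \<open>z \<ge> 1\<close> to
  those for \<open>n - c\<close>. For \<open>n < c\<close> there are none of either kind, so no
  lower bound on \<open>n\<close> is imposed.\<close>

lemma num_solutions_step:
  assumes "a > 0" "b > 0" "c > 0"
  shows "num_solutions a b c n = num_solutions a b c (n - c)
    + card {(x, y). 0 \<le> x \<and> 0 \<le> y \<and> a * x + b * y = n}"
proof -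
  let ?S = "\<lambda>n. {(x, y, z). 0 \<le> x \<and> 0 \<le> y \<and> 0 \<le> z \<and> a * x + b * y + c * z = n}"
  let ?T = "{(x, y). 0 \<le> x \<and> 0 \<le> y \<and> a * x + b * y = n}"
  let ?f = "\<lambda>(x, y, z). (x, y, z + 1)" and ?g = "\<lambda>(x, y). (x, y, 0 :: int)"
  have split: "?S n = ?f ` ?S (n - c) \<union> ?g ` ?T"
  proof (intro equalityI subsetI)
    fix p assume "p \<in> ?S n"
    then obtain x y z where p: "p = (x, y, z)"
      and xyz: "0 \<le> x" "0 \<le> y" "0 \<le> z" "a * x + b * y + c * z = n" by auto
    show "p \<in> ?f ` ?S (n - c) \<union> ?g ` ?T"
    proof (cases "z = 0")
      case True
      then have "p \<in> ?g ` ?T"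
        using p xyz by (intro image_eqI[of _ _ "(x, y)"]) auto
      then show ?thesis ..
    next
      case False
      then have "p \<in> ?f ` ?S (n - c)"
        using p xyz by (intro image_eqI[of _ _ "(x, y, z - 1)"]) (auto simp: algebra_simps)
      then show ?thesis ..
    qed
  qed (auto simp: algebra_simps)
  have fin: "finite (?S n)" using finite_solutions assms by blast
  have "card (?S n) = card (?f ` ?S (n - c)) + card (?g ` ?T)"
    unfolding split
  proof (rule card_Un_disjoint)
    show "finite (?f ` ?S (n - c))" "finite (?g ` ?T)"
      using fin unfolding split by simp_all
  qed auto
  also have "card (?f ` ?S (n - c)) = card (?S (n - c))"
    by (rule card_image) (auto simp: inj_on_def)
  also have "card (?g ` ?T) = card ?T"
    by (rule card_image) (auto simp: inj_on_def)
  finally show ?thesis by (simp add: num_solutions_def)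
qed

lemma num_solutions_zero:
  assumes "a > 0" "b > 0" "c > 0"
  shows "num_solutions a b c 0 = 1"
proof -
  have "{(x, y, z). 0 \<le> x \<and> 0 \<le> y \<and> 0 \<le> z \<and> a * x + b * y + c * z = 0} = {(0, 0, 0)}"
  proof (intro equalityI subsetI)
    fix p assume "p \<in> {(x, y, z). 0 \<le> x \<and> 0 \<le> y \<and> 0 \<le> z \<and> a * x + b * y + c * z = 0}"
    then obtain x y z where p: "p = (x, y, z)"
      and xyz: "0 \<le> x" "0 \<le> y" "0 \<le> z" "a * x + b * y + c * z = 0" by auto
    have "0 \<le> a * x" "0 \<le> b * y" "0 \<le> c * z" using xyz assms by simp_all
    then have "a * x = 0" "b * y = 0" "c * z = 0" using xyz(4) by linarith+
    then show "p \<in> {(0, 0, 0)}" using p assms by simp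
  qed auto
  then show ?thesis by (simp add: num_solutions_def)
qed

section \<open>The closed form and its recurrence\<close>

text \<open>This is \<open>2 * a * b * c\<close> times the claimed right-hand side; the final term
  is the constant -2 of the theorem after scaling.\<close>

definition quasi_poly :: "int \<Rightarrow> int \<Rightarrow> int \<Rightarrow> int \<Rightarrow> int" where
  "quasi_poly a b c n = n * (n + a + b + c)
     + b * c * dedekind_part a (b * modular_inverse a c) (- n * modular_inverse a b)
     + c * a * dedekind_part b (c * modular_inverse b a) (- n * modular_inverse b c)
     + a * b * dedekind_part c (a * modular_inverse c b) (- n * modular_inverse c a)
     - 4 * a * b * c"

lemma quasi_poly_rotate: "quasi_poly a b c n = quasi_poly b c a n"
  by (simp add: quasi_poly_def algebra_simps)

lemma coprime_mult_modular_inverse: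
  fixes m x y :: int
  assumes "coprime x m" "coprime y m"
  shows "coprime (x * modular_inverse m y) m"
  using assms by simp

lemma dvd_add_mult_neg_inverse:
  fixes m n x u :: int
  assumes "coprime x m" and "[u = - n * modular_inverse m x] (mod m)"
  shows "m dvd n + x * u"
proof -
  have "[n + x * u = n + x * (- n * modular_inverse m x)] (mod m)"
    by (intro cong_add cong_mult assms(2)) auto
  also have "n + x * (- n * modular_inverse m x) = n - n * (x * modular_inverse m x)"
    by (simp add: algebra_simps)
  also have "[n - n * (x * modular_inverse m x) = n - n * 1] (mod m)"
    by (intro cong_diff cong_mult cong_modular_inverse1 assms(1)) auto
  finally show ?thesis by (simp add: cong_0_iff)
qed

text \<open>Passing from \<open>n\<close> to \<open>n - c\<close> moves the three periodic terms
  differently. Modulo \<open>a\<close> the argument shifts by the inverse of the multiplier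
  \<open>?k\<close>, modulo \<open>b\<close> it shifts by 1, and modulo \<open>c\<close> it does not
  change.\<close>

lemma quasi_poly_step:
  assumes pos: "a > 0" "b > 0" "c > 0" "n \<ge> 0"
    and cop: "coprime a b" "coprime b c" "coprime c a"
  shows "quasi_poly a b c n - quasi_poly a b c (n - c)
    = 2 * a * b * c * int (card {(x, y). 0 \<le> x \<and> 0 \<le> y \<and> a * x + b * y = n})"
proof -
  have cop': "coprime b a" "coprime c b" "coprime a c"
    using cop by (simp_all add: coprime_commute)
  define u where "u = pos_residue a (- n * modular_inverse a b)"
  define v where "v = pos_residue b (- n * modular_inverse b a)"
  let ?k = "b * modular_inverse a c" and ?e = "c * modular_inverse a b"
  have "[(b * modular_inverse a b) * (c * modular_inverse a c) = 1 * 1] (mod a)"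
    by (intro cong_mult cong_modular_inverse1 cop cop')
  then have "[?k * ?e = 1] (mod a)" by (simp add: mult_ac)
  from dedekind_part_add_inverse[OF pos(1) this, of "- n * modular_inverse a b"]
  have A: "dedekind_part a ?k (- (n - c) * modular_inverse a b)
      - dedekind_part a ?k (- n * modular_inverse a b) = a + 1 - 2 * u"
    by (simp add: u_def algebra_simps)
  let ?l = "c * modular_inverse b a" and ?t = "- n * modular_inverse b c"
  have inv_c: "[c * modular_inverse b c = 1] (mod b)"
    by (intro cong_modular_inverse1 cop')
  have "dedekind_part b ?l (- (n - c) * modular_inverse b c) = dedekind_part b ?l (?t + 1)"
    using cong_add[OF cong_refl[of ?t] inv_c]
    by (intro dedekind_part_cong) (auto simp: algebra_simps)
  moreover have "pos_residue b (?l * ?t) = v"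
  proof -
    have "[(- n * modular_inverse b a) * (c * modular_inverse b c)
        = (- n * modular_inverse b a) * 1] (mod b)"
      by (intro cong_mult inv_c cong_refl)
    then show ?thesis unfolding v_def by (intro pos_residue_eqI) (simp add: mult_ac)
  qed
  ultimately have B: "dedekind_part b ?l (- (n - c) * modular_inverse b c)
      - dedekind_part b ?l ?t = b + 1 - 2 * v"
    using dedekind_part_add_one[OF pos(2) coprime_mult_modular_inverse[OF cop'(2) cop(1)], of ?t]
    by simp
  have inv_a: "[n * modular_inverse c a - c * modular_inverse c a = n * modular_inverse c a - 0] (mod c)"
    by (intro cong_diff cong_refl) (simp add: cong_0_iff)
  have C: "dedekind_part c (a * modular_inverse c b) (- (n - c) * modular_inverse c a)
      = dedekind_part c (a * modular_inverse c b) (- n * modular_inverse c a)"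
    using inv_a
    by (intro dedekind_part_cong cong_refl) (simp add: cong_iff_dvd_diff algebra_simps)
  let ?N = "int (card {(x, y). 0 \<le> x \<and> 0 \<le> y \<and> a * x + b * y = n})"
  have N: "a * b * ?N = n + b * u + a * v - a * b"
    unfolding u_def v_def
    by (intro card_two_variable_solutions pos cop(1) pos_residue_bounds
        dvd_add_mult_neg_inverse[OF _ pos_residue_cong] cop')
  have "quasi_poly a b c n - quasi_poly a b c (n - c)
      = c * (2 * n + a + b) - b * c * (a + 1 - 2 * u) - c * a * (b + 1 - 2 * v)"
    unfolding quasi_poly_def C A[symmetric] B[symmetric] by (simp add: algebra_simps)
  \<comment> \<open>The terms \<open>c * a\<close> and \<open>b * c\<close> cancel, leaving
    \<open>2 * c\<close> times the right-hand side of \<open>N\<close>.\<close>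
  also have "\<dots> = 2 * c * (a * b * ?N)"
    unfolding N by (simp add: algebra_simps)
  finally show ?thesis by (simp add: mult_ac)
qed

text \<open>At \<open>n = 0\<close> every periodic term has argument 0 and contributes
  \<open>2 * a * b * c\<close>; three of these minus \<open>4 * a * b * c\<close> remain.\<close>

lemma quasi_poly_zero:
  assumes "a > 0" "b > 0" "c > 0" and cop: "coprime a b" "coprime b c" "coprime c a"
  shows "quasi_poly a b c 0 = 2 * a * b * c"
proof -
  have "coprime b a" "coprime c b" "coprime a c"
    using cop by (simp_all add: coprime_commute)
  then show ?thesis
    using assms by (simp add: quasi_poly_def dedekind_part_of_dvd algebra_simps)
qed

section \<open>Functions with two coprime periods\<close>

lemma periodic_add_mult:
  fixes f :: "int \<Rightarrow> 'a" and p :: int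
  assumes "p > 0" and "\<And>n. n \<ge> 0 \<Longrightarrow> f (n + p) = f n" and "n \<ge> 0"
  shows "f (n + p * int j) = f n"
proof (induction j)
  case (Suc j)
  have "f (n + p * int (Suc j)) = f ((n + p * int j) + p)" by (simp add: algebra_simps)
  also have "\<dots> = f (n + p * int j)" using assms by (intro assms(2)) simp
  finally show ?case using Suc by simp
qed simp

text \<open>Periodicity is available only on non-negative arguments, so the path from 0 to
  \<open>n\<close> must stay there: climb by steps of \<open>p\<close> to some \<open>p * s\<close>
  congruent to \<open>n\<close> modulo \<open>q\<close>, then compare \<open>p * s\<close> with
  \<open>n\<close> by steps of \<open>q\<close>, always upwards from the smaller of the two.\<close>

lemma constant_of_coprime_periods:
  fixes f :: "int \<Rightarrow> 'a" and p q n :: int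
  assumes "p > 0" "q > 0" "coprime p q" "n \<ge> 0"
    and per_p: "\<And>n. n \<ge> 0 \<Longrightarrow> f (n + p) = f n" and per_q: "\<And>n. n \<ge> 0 \<Longrightarrow> f (n + q) = f n"
  shows "f n = f 0"
proof -
  \<comment> \<open>The modular inverse is taken non-negative, so \<open>p * s\<close> is reachable
    from 0.\<close>
  define s where "s = modular_inverse q p * n"
  have "s \<ge> 0" using assms by (simp add: s_def modular_inverse_int_nonneg)
  have "[p * modular_inverse q p * n = 1 * n] (mod q)"
    by (intro cong_mult cong_modular_inverse1 assms cong_refl)
  then have "q dvd p * s - n" by (simp add: s_def cong_iff_dvd_diff mult_ac)
  then obtain w where w: "p * s - n = q * w" by (elim dvdE)
  have "f (p * s) = f 0"
    using periodic_add_mult[of p f 0 "nat s"] assms \<open>s \<ge> 0\<close> by simp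
  moreover have "f (p * s) = f n"
  proof (cases "w \<ge> 0")
    case True
    then show ?thesis
      using periodic_add_mult[of q f n "nat w"] assms w by (simp add: algebra_simps)
  next
    case False
    have "p * s \<ge> 0" using assms \<open>s \<ge> 0\<close> by simp
    have "f (p * s + q * int (nat (- w))) = f (p * s)"
      using periodic_add_mult[of q f "p * s" "nat (- w)"] assms \<open>p * s \<ge> 0\<close> by simp
    moreover have "p * s + q * int (nat (- w)) = n" using False w by simp
    ultimately show ?thesis by simp
  qed
  ultimately show ?thesis by simp
qed

section \<open>Comparison of the count with the closed form\<close>

lemma num_solutions_eq_quasi_poly:
  assumes pos: "a > 0" "b > 0" "c > 0" "n \<ge> 0"
    and cop: "coprime a b" "coprime b c" "coprime c a"
  shows "2 * a * b * c * int (num_solutions a b c n) = quasi_poly a b c n"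
proof -
  define D where "D n = 2 * a * b * c * int (num_solutions a b c n) - quasi_poly a b c n" for n
  have "D (m + c) = D m" if "m \<ge> 0" for m
    using num_solutions_step[of a b c "m + c"] quasi_poly_step[of a b c "m + c"] pos cop that
    by (simp add: D_def algebra_simps)
  \<comment> \<open>Rotating to \<open>b, c, a\<close> puts \<open>a\<close> in the last position,
    where the recurrences apply.\<close>
  moreover have "D (m + a) = D m" if "m \<ge> 0" for m
    using num_solutions_step[of b c a "m + a"] quasi_poly_step[of b c a "m + a"] pos cop that
    by (simp add: D_def num_solutions_rotate[of a b c] quasi_poly_rotate[of a b c] algebra_simps)
  ultimately have "D n = D 0"
    using constant_of_coprime_periods[of c a n D] pos cop by simp
  then show ?thesis
    using num_solutions_zero[of a b c] quasi_poly_zero[of a b c] pos cop by (simp add: D_def)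
qed

theorem theorem4:
  fixes a b c n b1 c1 c2 a2 a3 b3 N1 :: int
  assumes "a > 0" and "b > 0" and "c > 0" and "n > 0"
    and "gcd a b = 1" and "gcd b c = 1" and "gcd c a = 1"
    and "[b1 = - n * modular_inverse a b] (mod a)" and "1 \<le> b1" and "b1 \<le> a"
    and "[c1 = b * modular_inverse a c] (mod a)" and "1 \<le> c1" and "c1 \<le> a"
    and "[c2 = - n * modular_inverse b c] (mod b)" and "1 \<le> c2" and "c2 \<le> b"
    and "[a2 = c * modular_inverse b a] (mod b)" and "1 \<le> a2" and "a2 \<le> b"
    and "[a3 = - n * modular_inverse c a] (mod c)" and "1 \<le> a3" and "a3 \<le> c"
    and "[b3 = a * modular_inverse c b] (mod c)" and "1 \<le> b3" and "b3 \<le> c"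
    and "N1 = n * (n + a + b + c)
            + c * b * b1 * (a + 1 - c1 * (b1 - 1))
            + a * c * c2 * (b + 1 - a2 * (c2 - 1))
            + b * a * a3 * (c + 1 - b3 * (a3 - 1))"
  shows "real (num_solutions a b c n) =
           real_of_int N1 / real_of_int (2 * a * b * c)
           + real_of_int (\<Sum>i = 1..b1 - 1. \<lfloor>real_of_int (i * c1) / real_of_int a\<rfloor>)
           + real_of_int (\<Sum>i = 1..c2 - 1. \<lfloor>real_of_int (i * a2) / real_of_int b\<rfloor>)
           + real_of_int (\<Sum>i = 1..a3 - 1. \<lfloor>real_of_int (i * b3) / real_of_int c\<rfloor>)
           - 2"
proof -
  have cop: "coprime a b" "coprime b c" "coprime c a"
    using assms(5-7) by (simp_all add: coprime_iff_gcd_eq_1)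
  define s1 where "s1 = (\<Sum>i = 1..b1 - 1. \<lfloor>real_of_int (i * c1) / real_of_int a\<rfloor>)"
  define s2 where "s2 = (\<Sum>i = 1..c2 - 1. \<lfloor>real_of_int (i * a2) / real_of_int b\<rfloor>)"
  define s3 where "s3 = (\<Sum>i = 1..a3 - 1. \<lfloor>real_of_int (i * b3) / real_of_int c\<rfloor>)"
  \<comment> \<open>\<open>dedekind_part\<close> depends only on residue classes, so the given
    representatives may replace the expressions with modular inverses.\<close>
  have "dedekind_part a (b * modular_inverse a c) (- n * modular_inverse a b) = dedekind_part a c1 b1"
    using assms(8,11) by (intro dedekind_part_cong) (simp_all only: cong_sym)
  moreover have "dedekind_part b (c * modular_inverse b a) (- n * modular_inverse b c) = dedekind_part b a2 c2"
    using assms(14,17) by (intro dedekind_part_cong) (simp_all only: cong_sym)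
  moreover have "dedekind_part c (a * modular_inverse c b) (- n * modular_inverse c a) = dedekind_part c b3 a3"
    using assms(20,23) by (intro dedekind_part_cong) (simp_all only: cong_sym)
  ultimately have "2 * a * b * c * int (num_solutions a b c n)
      = n * (n + a + b + c) + b * c * dedekind_part a c1 b1 + c * a * dedekind_part b a2 c2
        + a * b * dedekind_part c b3 a3 - 4 * a * b * c"
    using num_solutions_eq_quasi_poly[of a b c n] assms(1-4) cop by (simp only: quasi_poly_def less_imp_le)
  \<comment> \<open>Each floor sum carries twice its own modulus, which the product of the other two
    completes to \<open>2 * a * b * c\<close>.\<close>
  also have "\<dots> = N1 + 2 * a * b * c * (s1 + s2 + s3 - 2)"
    unfolding dedekind_part_floor[OF assms(9,10)] dedekind_part_floor[OF assms(15,16)]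
      dedekind_part_floor[OF assms(21,22)] s1_def[symmetric] s2_def[symmetric] s3_def[symmetric]
      assms(26)
    by (simp add: algebra_simps)
  finally have "real_of_int (2 * a * b * c) * real (num_solutions a b c n)
      = real_of_int N1 + real_of_int (2 * a * b * c) * (real_of_int (s1 + s2 + s3 - 2))"
    by (metis of_int_add of_int_mult of_int_of_nat_eq)
  moreover have "real_of_int (2 * a * b * c) \<noteq> 0" using assms(1-3) by simp
  ultimately have "real (num_solutions a b c n)
      = real_of_int N1 / real_of_int (2 * a * b * c) + real_of_int (s1 + s2 + s3 - 2)"
    by (simp add: field_simps del: of_int_mult)
  then show ?thesis
    unfolding s1_def[symmetric] s2_def[symmetric] s3_def[symmetric] by simp
qed

end
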